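(* Any streaming algorithm for \textsc{Connectivity} in the AL model that works on a family of graphs including all graphs of maximum degree $2$ and uses $p$ passes over the stream requires $\Omega(n/p)$ bits of memory on $n$-vertex graphs.
   Context: \textsc{Connectivity}: decide whether the graph is connected. In the Adjacency List (AL) streaming model the graph arrives as a sequence of vertices in arbitrary fixed order, each with the full list of its incident edges (each edge appears twice). A $p$-pass algorithm reads the sequence $p$ times with unlimited computation; memory is in bits. "Requires $\Omega(f)$ bits" means there is a constant $c>0$ such that every such algorithm uses at least $cf$ bits on some $n$-vertex input of the class, for all sufficiently large $n$ and all $p$. *)

theory Defs
  imports "Graph_Theory.Graph_Theory" "HOL-Probability.Probability_Mass_Function"
begin

text \<open>
  A finite simple graph is a \<^locale>\<open>pair_graph\<close>: an undirected edge \<open>{u, v}\<close> is the pair of arcs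
  \<open>(u, v)\<close>, \<open>(v, u)\<close>. The out-arcs of a vertex are thus its incident edges, and its out-degree is
  its degree.
\<close>

definition n_vertex_graph :: "nat \<Rightarrow> nat pair_pre_digraph \<Rightarrow> bool" where
  "n_vertex_graph n G \<longleftrightarrow> pair_graph G \<and> verts (with_proj G) = {..<n}"

(* The element 0 only matters for the graph without vertices. *)
definition max_degree :: "nat pair_pre_digraph \<Rightarrow> nat" where
  "max_degree G = Max (insert 0 (out_degree (with_proj G) ` verts (with_proj G)))"


type_synonym al_entry = "nat \<times> (nat \<times> nat) list"

text \<open>
  An adjacency list stream of a graph. Both the order of the vertices and the order inside each
  list are arbitrary; each edge occurs twice in the stream, once at either end.
\<close>

definition al_stream :: "nat pair_pre_digraph \<Rightarrow> al_entry list \<Rightarrow> bool" where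
  "al_stream G \<sigma> \<longleftrightarrow>
     distinct (map fst \<sigma>) \<and> set (map fst \<sigma>) = verts (with_proj G) \<and>
     (\<forall>(v, es) \<in> set \<sigma>. distinct es \<and> set es = out_arcs (with_proj G) v)"


text \<open>
  A deterministic algorithm. The memory contents are a bit string; the update and answer functions
  are arbitrary (unlimited computation). The update function is also given the number of stream
  entries read so far, hence the pass and the position in it, at no memory cost. This allows more
  algorithms, including all those that ignore the clock or that keep it in memory.
\<close>

record al_algorithm =
  initial :: "bool list"
  update :: "nat \<Rightarrow> al_entry \<Rightarrow> bool list \<Rightarrow> bool list"
  answer :: "bool list \<Rightarrow> bool"

(* The index modulo the length of the stream makes the reading start over after each pass. *)
primrec memory_at :: "al_algorithm \<Rightarrow> al_entry list \<Rightarrow> nat \<Rightarrow> bool list" where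
  "memory_at A \<sigma> 0 = initial A"
| "memory_at A \<sigma> (Suc t) = update A t (\<sigma> ! (t mod length \<sigma>)) (memory_at A \<sigma> t)"

definition accepts :: "al_algorithm \<Rightarrow> nat \<Rightarrow> al_entry list \<Rightarrow> bool" where
  "accepts A p \<sigma> \<longleftrightarrow> answer A (memory_at A \<sigma> (p * length \<sigma>))"

definition bits_used :: "al_algorithm \<Rightarrow> nat \<Rightarrow> al_entry list \<Rightarrow> nat" where
  "bits_used A p \<sigma> = Max ((\<lambda>t. length (memory_at A \<sigma> t)) ` {..p * length \<sigma>})"


text \<open>
  A streaming algorithm is a distribution \<open>D\<close> over deterministic ones, which has to answer correctly
  with probability at least \<open>2/3\<close> on every graph of the class \<open>F\<close> and every stream of it; coins tossed
  during the run are covered because the update function has access to the clock. A deterministic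
  algorithm is a point distribution and has to be correct always.
\<close>

definition solves_connectivity ::
    "nat pair_pre_digraph set \<Rightarrow> nat \<Rightarrow> nat \<Rightarrow> al_algorithm pmf \<Rightarrow> bool" where
  "solves_connectivity F n p D \<longleftrightarrow>
     (\<forall>G \<in> F. n_vertex_graph n G \<longrightarrow> (\<forall>\<sigma>. al_stream G \<sigma> \<longrightarrow>
        measure_pmf.prob D {A. accepts A p \<sigma> \<longleftrightarrow> Digraph_Component.connected (with_proj G)} \<ge> 2 / 3))"

lemma solves_connectivity_deterministic:
  "solves_connectivity F n p (return_pmf A) \<longleftrightarrow>
     (\<forall>G \<in> F. n_vertex_graph n G \<longrightarrow> (\<forall>\<sigma>. al_stream G \<sigma> \<longrightarrow>
        (accepts A p \<sigma> \<longleftrightarrow> Digraph_Component.connected (with_proj G))))"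
  unfolding solves_connectivity_def by (auto simp: indicator_def)

end

theory Submission
  imports Defs
begin

text \<open>
  Alice holds a set \<open>X\<close> and Bob a set \<open>Y\<close>. From these we build a disjoint union of cycles whose vertices
  lie on three tracks running through a cyclic sequence of columns. Every fourth column starts a block
  \<open>i\<close>: Alice rotates the tracks by one if \<open>i \<in> X\<close>, and Bob reflects them before and after her if
  \<open>i \<in> Y\<close>, which inverts the rotation. Going once around therefore rotates the tracks by
  \<open>|X - Y| - |X \<inter> Y|\<close>, plus one more in the last layer, and the graph is connected iff this number is not
  divisible by 3. Each edge layer that depends on \<open>X\<close> joins two columns of Alice, and the same for Bob,
  so the first part of the stream depends on \<open>X\<close> only and the rest on \<open>Y\<close> only.

  The \<open>2p\<close> memory states at the moments when the stream changes hands split the inputs of a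
  deterministic algorithm into combinatorial rectangles on which it gives a constant answer. The character
  \<open>\<omega> ^ (|X - Y| - |X \<inter> Y|)\<close>, with \<open>\<omega>\<close> a primitive cube root of unity, has small sum over every
  rectangle (Lindsey's lemma), so few rectangles cannot correlate with connectivity. Averaging over the
  random algorithm gives the bound.
\<close>

section \<open>The discrepancy of a cubic character\<close>

definition signed_size :: "nat set \<Rightarrow> nat set \<Rightarrow> int" where
  "signed_size X Y = (\<Sum>i\<in>X. if i \<in> Y then -1 else 1)"

abbreviation "\<omega> \<equiv> cis (2 * pi / 3)"

definition cubic_char :: "nat set \<Rightarrow> nat set \<Rightarrow> complex" where
  "cubic_char X Y = (\<Prod>i\<in>X. if i \<in> Y then cnj \<omega> else \<omega>)"

lemma cubic_char_eq:
  assumes "finite X"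
  shows "cubic_char X Y = cis (2 * pi / 3 * of_int (signed_size X Y))"
  using assms
proof (induction X)
  case empty
  show ?case by (simp add: cubic_char_def signed_size_def)
next
  case (insert i X)
  then show ?case
    by (auto simp: cubic_char_def signed_size_def cis_cnj cis_mult algebra_simps)
qed

text \<open>
  The values 2 and -1 are \<open>2 Re (\<omega> ^ j)\<close> for \<open>j = 0\<close> and \<open>j \<noteq> 0\<close> modulo 3. The sign says whether the graph built from
  \<open>X\<close> and \<open>Y\<close> below is connected.
\<close>

definition gap :: "nat set \<Rightarrow> nat set \<Rightarrow> real" where
  "gap X Y = (if 3 dvd 1 + signed_size X Y then 2 else -1)"

lemma cos_third_turns: "2 * cos (2 * pi / 3 * of_int m) = (if 3 dvd m then 2 else -1)"
proof -
  define q r where "q = m div 3" and "r = m mod 3"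
  have m: "m = 3 * q + r" and r: "r = 0 \<or> r = 1 \<or> r = 2"
    by (auto simp: q_def r_def)
  have "cos (2 * pi / 3 * of_int m) = cos (2 * pi / 3 * of_int r + 2 * pi * of_int q)"
    by (simp add: m field_simps)
  also have "\<dots> = cos (2 * pi / 3 * of_int r)"
    by (simp add: cos_add)
  finally have "cos (2 * pi / 3 * of_int m) = cos (2 * pi / 3 * of_int r)" .
  moreover have "cos (2 * pi / 3 * 2) = - (1 / 2)"
    using cos_double_cos[of "2 * pi / 3"] by (simp only: cos_120) (simp add: mult.commute power2_eq_square)
  moreover have "3 dvd m \<longleftrightarrow> r = 0"
    by (auto simp: r_def)
  ultimately show ?thesis
    using r by (auto simp: cos_120)
qed

text \<open>The factor \<open>\<omega>\<close> is the extra shift by one track in the closing layer.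
  A cube root of unity has real part 1 or -1/2, so twice the real part takes just the two values of
  \<open>gap\<close>.\<close>

lemma gap_eq:
  assumes "finite X"
  shows "gap X Y = 2 * Re (\<omega> * cubic_char X Y)"
proof -
  have "\<omega> * cubic_char X Y = cis (2 * pi / 3 * of_int (1 + signed_size X Y))"
    by (simp add: cubic_char_eq[OF assms] cis_mult field_simps)
  then show ?thesis
    using cos_third_turns[of "1 + signed_size X Y"] by (simp add: gap_def)
qed

text \<open>Each \<open>i\<close> enters \<open>Y\<close> independently, so the sum factors over
  \<open>I\<close>, with \<open>f i\<close> for \<open>i\<close> inside \<open>Y\<close> and
  \<open>g i\<close> for \<open>i\<close> outside. Where \<open>X\<close> and \<open>X'\<close>
  agree the two options give 1 + 1, elsewhere \<open>\<omega> + cnj \<omega> = -1\<close>.\<close>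

lemma sum_cubic_char_mult_cnj:
  assumes I: "finite I" and X: "X \<subseteq> I" "X' \<subseteq> I"
  shows "(\<Sum>Y\<in>Pow I. cubic_char X Y * cnj (cubic_char X' Y))
       = (\<Prod>i\<in>I. if (i \<in> X) = (i \<in> X') then 2 else -1)"
proof -
  define f :: "nat \<Rightarrow> complex" where
    "f i = (if i \<in> X then cnj \<omega> else 1) * (if i \<in> X' then \<omega> else 1)" for i
  define g :: "nat \<Rightarrow> complex" where
    "g i = (if i \<in> X then \<omega> else 1) * (if i \<in> X' then cnj \<omega> else 1)" for i
  have split: "cubic_char Z Y = (\<Prod>i\<in>Y. if i \<in> Z then cnj \<omega> else 1) * (\<Prod>i\<in>I - Y. if i \<in> Z then \<omega> else 1)"
    if "Y \<subseteq> I" "Z \<subseteq> I" for Y Z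
  proof -
    have "cubic_char Z Y = (\<Prod>i\<in>I. if i \<in> Z then (if i \<in> Y then cnj \<omega> else \<omega>) else 1)"
      unfolding cubic_char_def using that I
      by (auto simp: prod.If_cases Int_absorb1 intro!: prod.cong)
    also have "\<dots> = (\<Prod>i\<in>Y. if i \<in> Z then cnj \<omega> else 1) * (\<Prod>i\<in>I - Y. if i \<in> Z then \<omega> else 1)"
      using that I by (subst prod.subset_diff[of Y I]) (auto simp: mult.commute intro!: arg_cong2[where f = "(*)"] prod.cong)
    finally show ?thesis .
  qed
  have "cubic_char X Y * cnj (cubic_char X' Y) = prod f Y * prod g (I - Y)" if "Y \<in> Pow I" for Y
    using that X by (auto simp: split f_def g_def prod.distrib if_distrib[of cnj] cong: if_cong)
  then have "(\<Sum>Y\<in>Pow I. cubic_char X Y * cnj (cubic_char X' Y)) = (\<Prod>i\<in>I. f i + g i)"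
    by (simp add: prod_add[OF I])
  also have "\<dots> = (\<Prod>i\<in>I. if (i \<in> X) = (i \<in> X') then 2 else -1)"
    by (intro prod.cong)
      (auto simp: f_def g_def cis_cnj cis_mult complex_eq_iff cos_120 sin_120)
  finally show ?thesis .
qed

text \<open>Lindsey's argument by Cauchy-Schwarz. The rows are not orthogonal, but the absolute
  correlations of one row with all rows sum to \<open>3 ^ card I\<close>, so the squared sum is at
  most 2 * 2 * 3 = 12 per coordinate, against 16 for the trivial bound.\<close>

lemma sum_cubic_char_rectangle:
  assumes I: "finite I" and A: "A \<subseteq> Pow I" and B: "B \<subseteq> Pow I"
  shows "norm (\<Sum>X\<in>A. \<Sum>Y\<in>B. cubic_char X Y) \<le> sqrt 12 ^ card I"
proof -
  define h where "h Y = (\<Sum>X\<in>A. cubic_char X Y)" for Y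
  have fin: "finite A" "finite B" "finite (Pow I)"
    using I finite_subset[OF A] finite_subset[OF B] by blast+
  have card: "real (card C) \<le> 2 ^ card I" if "C \<subseteq> Pow I" for C
    using card_mono[OF fin(3) that] by (simp add: card_Pow[OF I])
  \<comment> \<open>Letting \<open>X'\<close> run over all subsets makes the sum a product again:
    each \<open>i\<close> contributes 2 for agreement with \<open>X\<close> plus 1 for
    disagreement.\<close>
  have row: "(\<Sum>X'\<in>A. norm (\<Sum>Y\<in>Pow I. cubic_char X Y * cnj (cubic_char X' Y))) \<le> 3 ^ card I"
    if "X \<in> A" for X
  proof -
    have "(\<Sum>X'\<in>A. norm (\<Sum>Y\<in>Pow I. cubic_char X Y * cnj (cubic_char X' Y)))
        \<le> (\<Sum>X'\<in>Pow I. norm (\<Sum>Y\<in>Pow I. cubic_char X Y * cnj (cubic_char X' Y)))"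
      by (rule sum_mono2[OF fin(3) A]) simp
    also have "\<dots> = (\<Sum>X'\<in>Pow I. \<Prod>i\<in>I. if (i \<in> X) = (i \<in> X') then 2 else 1)"
    proof (intro sum.cong refl)
      fix X' assume "X' \<in> Pow I"
      moreover have "X \<subseteq> I"
        using A \<open>X \<in> A\<close> by blast
      ultimately show "norm (\<Sum>Y\<in>Pow I. cubic_char X Y * cnj (cubic_char X' Y))
          = (\<Prod>i\<in>I. if (i \<in> X) = (i \<in> X') then 2 else 1)"
        by (auto simp: sum_cubic_char_mult_cnj[OF I] prod_norm[symmetric] intro!: prod.cong)
    qed
    also have "\<dots> = (\<Sum>X'\<in>Pow I. (\<Prod>i\<in>X'. if i \<in> X then 2 else 1) * (\<Prod>i\<in>I - X'. if i \<in> X then 1 else 2))"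
    proof (intro sum.cong refl)
      fix X' assume "X' \<in> Pow I"
      then show "(\<Prod>i\<in>I. if (i \<in> X) = (i \<in> X') then 2 else 1)
          = (\<Prod>i\<in>X'. if i \<in> X then 2 else 1) * (\<Prod>i\<in>I - X'. if i \<in> X then 1 else 2 :: real)"
        using I by (subst prod.subset_diff[of X' I])
          (auto simp: mult.commute intro!: arg_cong2[where f = "(*)"] prod.cong)
    qed
    also have "\<dots> = (\<Prod>i\<in>I. (if i \<in> X then 2 else 1) + (if i \<in> X then 1 else 2))"
      by (rule prod_add[OF I, symmetric])
    also have "\<dots> = (\<Prod>i\<in>I. 3)"
      by (intro prod.cong) auto
    finally show ?thesis by simp
  qed
  have "(norm (\<Sum>X\<in>A. \<Sum>Y\<in>B. cubic_char X Y))\<^sup>2 = (norm (\<Sum>Y\<in>B. h Y))\<^sup>2"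
    by (subst sum.swap) (simp add: h_def)
  also have "\<dots> \<le> (\<Sum>Y\<in>B. 1 * norm (h Y))\<^sup>2"
    by (intro power_mono) (auto intro: norm_sum)
  also have "\<dots> \<le> (\<Sum>Y\<in>B. 1\<^sup>2) * (\<Sum>Y\<in>B. (norm (h Y))\<^sup>2)"
    by (rule Cauchy_Schwarz_ineq_sum)
  \<comment> \<open>Enlarging \<open>B\<close> to all subsets only adds nonnegative terms, and over
    all \<open>Y\<close> the row correlations are known exactly.\<close>
  also have "\<dots> \<le> 2 ^ card I * (\<Sum>Y\<in>Pow I. (norm (h Y))\<^sup>2)"
    using card[OF B] by (intro mult_mono sum_mono2[OF fin(3) B]) (auto intro: sum_nonneg)
  also have "(\<Sum>Y\<in>Pow I. (norm (h Y))\<^sup>2)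
      = Re (\<Sum>X\<in>A. \<Sum>X'\<in>A. \<Sum>Y\<in>Pow I. cubic_char X Y * cnj (cubic_char X' Y))"
  proof -
    have "complex_of_real (\<Sum>Y\<in>Pow I. (norm (h Y))\<^sup>2) = (\<Sum>Y\<in>Pow I. h Y * cnj (h Y))"
      by (simp only: of_real_sum complex_norm_square)
    also have "\<dots> = (\<Sum>Y\<in>Pow I. \<Sum>X\<in>A. \<Sum>X'\<in>A. cubic_char X Y * cnj (cubic_char X' Y))"
      by (simp add: h_def sum_product)
    also have "\<dots> = (\<Sum>X\<in>A. \<Sum>X'\<in>A. \<Sum>Y\<in>Pow I. cubic_char X Y * cnj (cubic_char X' Y))"
      by (rule trans[OF sum.swap], intro sum.cong refl sum.swap)
    finally show ?thesis by (metis Re_complex_of_real)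
  qed
  also have "\<dots> \<le> (\<Sum>X\<in>A. \<Sum>X'\<in>A. norm (\<Sum>Y\<in>Pow I. cubic_char X Y * cnj (cubic_char X' Y)))"
    by (rule order_trans[OF complex_Re_le_cmod], rule order_trans[OF norm_sum], intro sum_mono norm_sum)
  also have "\<dots> \<le> (\<Sum>X\<in>A. 3 ^ card I)"
    by (intro sum_mono row)
  also have "\<dots> \<le> 2 ^ card I * 3 ^ card I"
    using card[OF A] by simp
  finally have "(norm (\<Sum>X\<in>A. \<Sum>Y\<in>B. cubic_char X Y))\<^sup>2 \<le> 2 ^ card I * (2 ^ card I * 3 ^ card I)"
    by simp
  also have "\<dots> = (sqrt 12 ^ card I)\<^sup>2"
    by (simp add: power_mult_distrib[symmetric] power_even_eq[symmetric] power_mult[symmetric] mult.commute[of _ 2])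
      (simp add: power_mult)
  finally show ?thesis
    by (rule power2_le_imp_le) simp
qed

lemma gap_rectangle:
  assumes I: "finite I" and A: "A \<subseteq> Pow I" and B: "B \<subseteq> Pow I"
  shows "\<bar>\<Sum>X\<in>A. \<Sum>Y\<in>B. gap X Y\<bar> \<le> 2 * sqrt 12 ^ card I"
proof -
  have "(\<Sum>X\<in>A. \<Sum>Y\<in>B. gap X Y) = (\<Sum>X\<in>A. \<Sum>Y\<in>B. 2 * Re (\<omega> * cubic_char X Y))"
    using A I by (intro sum.cong refl gap_eq) (auto intro: finite_subset)
  also have "\<dots> = 2 * Re (\<omega> * (\<Sum>X\<in>A. \<Sum>Y\<in>B. cubic_char X Y))"
    by (simp only: sum_distrib_left Re_sum)
  finally have "\<bar>\<Sum>X\<in>A. \<Sum>Y\<in>B. gap X Y\<bar> = 2 * \<bar>Re (\<omega> * (\<Sum>X\<in>A. \<Sum>Y\<in>B. cubic_char X Y))\<bar>"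
    by (simp only: abs_mult abs_numeral)
  also have "\<dots> \<le> 2 * norm (\<omega> * (\<Sum>X\<in>A. \<Sum>Y\<in>B. cubic_char X Y))"
    by (intro mult_left_mono abs_Re_le_cmod) simp
  finally show ?thesis
    using sum_cubic_char_rectangle[OF assms] by (simp add: norm_mult)
qed

section \<open>Graphs of permutations\<close>

text \<open>For a permutation \<open>f\<close> without fixed points or 2-cycles this is the disjoint
  union of the cycles of \<open>f\<close>, taken as undirected cycles.\<close>

definition functional_graph :: "nat \<Rightarrow> (nat \<Rightarrow> nat) \<Rightarrow> nat pair_pre_digraph" where
  "functional_graph n f =
     \<lparr> pverts = {..<n}, parcs = {(u, v). u < n \<and> v < n \<and> (v = f u \<or> u = f v)} \<rparr>"

lemma functional_graph_sel [simp]: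
  "pverts (functional_graph n f) = {..<n}"
  "(u, v) \<in> parcs (functional_graph n f) \<longleftrightarrow> u < n \<and> v < n \<and> (v = f u \<or> u = f v)"
  by (auto simp: functional_graph_def)

lemma pair_graph_functional_graph:
  assumes "\<And>v. v < n \<Longrightarrow> f v \<noteq> v"
  shows "pair_graph (functional_graph n f)"
proof unfold_locales
  show "finite (parcs (functional_graph n f))"
    by (rule finite_subset[of _ "{..<n} \<times> {..<n}"]) auto
  show "fst e \<noteq> snd e" if "e \<in> parcs (functional_graph n f)" for e
    using that assms by (cases e) (auto dest: sym)
qed (auto simp: symmetric_def sym_def)

lemma max_degree_functional_graph:
  assumes "n > 0" and bij: "bij_betw f {..<n} {..<n}" and no2: "\<And>v. v < n \<Longrightarrow> f (f v) \<noteq> v"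
  shows "max_degree (functional_graph n f) = 2"
proof -
  have "out_degree (functional_graph n f) v = 2" if v: "v < n" for v
  proof -
    have "v \<in> f ` {..<n}"
      using v by (simp add: bij_betw_imp_surj_on[OF bij])
    then obtain u where u: "u < n" "f u = v"
      by auto
    have "f v < n"
      using bij_betw_apply[OF bij, of v] v by simp
    have uniq: "u' = u" if "u' < n" "f u' = v" for u'
      using inj_onD[OF bij_betw_imp_inj_on[OF bij], of u' u] that u by simp
    have "out_arcs (functional_graph n f) v = {(v, f v), (v, u)}"
      using u(1) u(2)[symmetric] v \<open>f v < n\<close> by (auto dest: uniq[OF _ sym])
    moreover have "f v \<noteq> u"
      using no2[of u] u by auto
    ultimately show ?thesis
      by (simp add: out_degree_def)
  qed
  then have "out_degree (functional_graph n f) ` {..<n} = {2}"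
    using \<open>n > 0\<close> by auto
  then show ?thesis
    by (simp add: max_degree_def)
qed

text \<open>Reachability from 0 is itself a predicate preserved by \<open>f\<close> in both
  directions, and it implies every other such predicate that holds at 0. In this form a disconnected
  graph needs one invariant, a connected one a propagation argument.\<close>

lemma connected_functional_graph:
  assumes "n > 0" and maps: "\<And>v. v < n \<Longrightarrow> f v < n" and "\<And>v. v < n \<Longrightarrow> f v \<noteq> v"
  shows "Digraph_Component.connected (functional_graph n f)
     \<longleftrightarrow> (\<forall>Q. Q 0 \<longrightarrow> (\<forall>v<n. Q v \<longleftrightarrow> Q (f v)) \<longrightarrow> (\<forall>v<n. Q v))"
proof -
  let ?G = "functional_graph n f"
  interpret pair_graph ?G
    by (rule pair_graph_functional_graph[OF assms(3)])
  have conn: "Digraph_Component.connected ?G \<longleftrightarrow> (\<forall>v<n. 0 \<rightarrow>\<^sup>*\<^bsub>?G\<^esub> v)"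
  proof
    assume "Digraph_Component.connected ?G"
    from symmetric_connected_imp_strongly_connected[OF sym_arcs this]
    show "\<forall>v<n. 0 \<rightarrow>\<^sup>*\<^bsub>?G\<^esub> v"
      using \<open>n > 0\<close> by (auto simp: strongly_connected_def)
  next
    assume *: "\<forall>v<n. 0 \<rightarrow>\<^sup>*\<^bsub>?G\<^esub> v"
    show "Digraph_Component.connected ?G"
    proof (rule connectedI)
      fix u v assume "u \<in> pverts ?G" "v \<in> pverts ?G"
      then have "u \<rightarrow>\<^sup>*\<^bsub>?G\<^esub> 0" "0 \<rightarrow>\<^sup>*\<^bsub>?G\<^esub> v"
        using * symmetric_reachable' by auto
      then show "u \<rightarrow>\<^sup>*\<^bsub>with_proj (mk_symmetric ?G)\<^esub> v"
        using reachable_trans reachable_mk_symmetric_eq sym_arcs by metis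
    qed (use \<open>n > 0\<close> in auto)
  qed
  have step: "0 \<rightarrow>\<^sup>*\<^bsub>?G\<^esub> v \<longleftrightarrow> 0 \<rightarrow>\<^sup>*\<^bsub>?G\<^esub> f v" if "v < n" for v
  proof -
    have "(v, f v) \<in> parcs ?G" "(f v, v) \<in> parcs ?G"
      using that maps by auto
    then show ?thesis
      by (meson adj_reachable_trans reachable_adj_trans)
  qed
  show ?thesis
    unfolding conn
  proof (intro iffI allI impI)
    fix Q v
    assume "\<forall>v<n. 0 \<rightarrow>\<^sup>*\<^bsub>?G\<^esub> v" and Q: "Q 0" "\<forall>v<n. Q v \<longleftrightarrow> Q (f v)" and "v < n"
    then have "0 \<rightarrow>\<^sup>*\<^bsub>?G\<^esub> v" by blast
    then show "Q v"
    proof (induction rule: reachable_induct)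
      case (step x y)
      then show ?case using Q(2) by auto
    qed (rule Q)
  next
    fix v
    assume *: "\<forall>Q. Q 0 \<longrightarrow> (\<forall>v<n. Q v \<longleftrightarrow> Q (f v)) \<longrightarrow> (\<forall>v<n. Q v)" and "v < n"
    have "0 \<rightarrow>\<^sup>*\<^bsub>?G\<^esub> 0"
      using \<open>n > 0\<close> by simp
    with * step \<open>v < n\<close> show "0 \<rightarrow>\<^sup>*\<^bsub>?G\<^esub> v" by blast
  qed
qed

section \<open>Three strands\<close>

text \<open>
  Vertex \<open>3 * c + r\<close> is on track \<open>r\<close> of column \<open>c\<close>. Block \<open>i\<close> consists of the columns \<open>4 * i, \<dots>, 4 * i + 3\<close>;
  its first two belong to Alice, the others to Bob. Bob's reflections at the end of a block and at the
  beginning of the next one are merged into one layer, where multiplication by 2 modulo 3 is the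
  reflection.
\<close>

definition turn :: "nat set \<Rightarrow> nat set \<Rightarrow> nat \<Rightarrow> nat \<Rightarrow> nat" where
  "turn X Y c r =
     (if c mod 4 = 0 \<and> c div 4 \<in> X then (r + 1) mod 3
      else if c mod 4 = 2 \<and> (c div 4 \<in> Y \<longleftrightarrow> Suc (c div 4) \<notin> Y) then 2 * r mod 3
      else r)"

definition twist :: "nat set \<Rightarrow> nat set \<Rightarrow> nat \<Rightarrow> nat" where
  "twist X Y v = 3 * (v div 3) + turn X Y (v div 3) (v mod 3)"

text \<open>
  The last column is \<open>4 * m + 3\<close>. It is joined to the first one with a shift by one track, and track 2
  passes on its way through all the vertices from \<open>12 * m + 12\<close> on, which fill the graph up to \<open>n\<close> vertices.
\<close>

definition advance :: "nat \<Rightarrow> nat \<Rightarrow> nat \<Rightarrow> nat" where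
  "advance m n v =
     (if v < 12 * m + 9 then v + 3 else if v < 12 * m + 11 then v - (12 * m + 8) else Suc v mod n)"

definition next_vertex :: "nat \<Rightarrow> nat \<Rightarrow> nat set \<Rightarrow> nat set \<Rightarrow> nat \<Rightarrow> nat" where
  "next_vertex m n X Y v = advance m n (twist X Y v)"

section \<open>Column arithmetic and the successor permutation\<close>

lemma less_3_cases: "r < 3 \<Longrightarrow> r = 0 \<or> r = 1 \<or> r = (2::nat)"
  by linarith

lemma turn_less: "r < 3 \<Longrightarrow> turn X Y c r < 3"
  by (auto simp: turn_def)

lemma inj_on_turn: "inj_on (turn X Y c) {..<3}"
  by (rule inj_onI) (auto simp: turn_def dest!: less_3_cases split: if_splits)

lemma turn_surj:
  assumes "r < 3"
  obtains r' where "r' < 3" "turn X Y c r' = r"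
proof -
  have "turn X Y c ` {..<3} = {..<3}"
    by (rule endo_inj_surj) (auto simp: turn_less inj_on_turn)
  with assms that show thesis
    by (metis image_iff lessThan_iff)
qed

lemma twist_column: "r < 3 \<Longrightarrow> twist X Y (3 * c + r) = 3 * c + turn X Y c r"
  by (simp add: twist_def)

lemma twist_div_3 [simp]: "twist X Y v div 3 = v div 3"
  using turn_less[of "v mod 3" X Y "v div 3"] by (simp add: twist_def)

lemma twist_mod_3 [simp]: "twist X Y v mod 3 = turn X Y (v div 3) (v mod 3)"
  using turn_less[of "v mod 3" X Y "v div 3"] by (simp add: twist_def)

lemma inj_twist: "inj (twist X Y)"
proof (rule injI)
  fix u v assume eq: "twist X Y u = twist X Y v"
  then have div3: "u div 3 = v div 3"
    by (metis twist_div_3)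
  have "turn X Y (v div 3) (u mod 3) = turn X Y (v div 3) (v mod 3)"
    using arg_cong[OF eq, of "\<lambda>w. w mod 3"] by (simp add: div3)
  then have "u mod 3 = v mod 3"
    by (rule inj_onD[OF inj_on_turn]) auto
  with div3 show "u = v"
    by (metis div_mult_mod_eq)
qed

lemma Suc_mod_eq: "v < n \<Longrightarrow> Suc v mod n = (if Suc v = n then 0 else Suc v)"
  by auto

lemma track_coords:
  fixes r :: nat
  assumes "r < 3" "v = r + 3 * c"
  shows "v div 3 = c" "v mod 3 = r"
  using assms by simp_all

lemma less_mult_3_iff: "v < 3 * a \<longleftrightarrow> v div 3 < (a :: nat)"
  by (simp add: div_less_iff_less_mult mult.commute)

text \<open>Inputs start at 1 because the reflection before block \<open>i\<close> sits in block
  \<open>i - 1\<close>. Blocks 0 to \<open>m\<close> take up 12 * m + 12 vertices.\<close>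

locale strands =
  fixes m n :: nat
  assumes m: "m \<ge> 1" and n: "12 * m + 12 \<le> n"
begin

abbreviation "inputs \<equiv> Pow {1..m}"

abbreviation "nxt \<equiv> next_vertex m n"

lemma less_columns:
  "v < 12 * m + 6 \<longleftrightarrow> v div 3 < 4 * m + 2"
  "v < 12 * m + 9 \<longleftrightarrow> v div 3 < 4 * m + 3"
  "v < 12 * m + 12 \<longleftrightarrow> v div 3 < 4 * m + 4"
  using less_mult_3_iff[of v "4 * m + 2"] less_mult_3_iff[of v "4 * m + 3"]
    less_mult_3_iff[of v "4 * m + 4"] by (simp_all add: add.commute)

text \<open>Columns congruent to 3 modulo 4 never turn, and blocks beyond \<open>m\<close> have no
  inputs; hence the last column and the padding stay fixed.\<close>

lemma turn_last: "X \<in> inputs \<Longrightarrow> Y \<in> inputs \<Longrightarrow> c \<ge> 4 * m + 3 \<Longrightarrow> turn X Y c r = r"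
proof -
  assume XY: "X \<in> inputs" "Y \<in> inputs" and c: "c \<ge> 4 * m + 3"
  have "c mod 4 = 3 \<or> c div 4 \<ge> Suc m"
    using c by presburger
  then show ?thesis
    using XY by (auto simp: turn_def subset_eq Ball_def)
qed

lemma twist_last:
  assumes "X \<in> inputs" "Y \<in> inputs" "v \<ge> 12 * m + 9"
  shows "twist X Y v = v"
proof -
  have "v div 3 \<ge> 4 * m + 3"
    using assms(3) less_columns(2)[of v] by simp
  then show ?thesis
    by (simp add: twist_def turn_last[OF assms(1,2)])
qed

lemma twist_less:
  assumes "X \<in> inputs" "Y \<in> inputs" "v < n"
  shows "twist X Y v < n"
proof (cases "v < 12 * m + 9")
  case True
  then have "twist X Y v < 12 * m + 9"
    by (simp only: less_columns twist_div_3)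
  then show ?thesis
    using n by linarith
qed (use twist_last assms in auto)

lemma next_less:
  assumes "X \<in> inputs" "Y \<in> inputs" "v < n"
  shows "nxt X Y v < n"
  using twist_less[OF assms] n m by (auto simp: next_vertex_def advance_def)

lemma inj_on_advance: "inj_on (advance m n) {..<n}"
  using m n by (intro inj_onI) (auto simp: advance_def Suc_mod_eq split: if_splits)

lemma next_column:
  assumes "c < 4 * m + 3" "r < 3"
  shows "nxt X Y (3 * c + r) = 3 * Suc c + turn X Y c r"
  using turn_less[OF assms(2), of X Y c] assms by (simp add: next_vertex_def twist_column advance_def)

lemma next_div_3:
  assumes "v < 12 * m + 9"
  shows "nxt X Y v div 3 = Suc (v div 3)"
proof -
  have "v div 3 < 4 * m + 3"
    using assms by (simp only: less_columns)
  from next_column[OF this, of "v mod 3" X Y]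
  have "nxt X Y v = turn X Y (v div 3) (v mod 3) + 3 * Suc (v div 3)"
    by simp
  moreover have "turn X Y (v div 3) (v mod 3) < 3"
    by (simp add: turn_less)
  ultimately show ?thesis
    by (rule track_coords(1)[rotated])
qed

lemma next_last:
  assumes "X \<in> inputs" "Y \<in> inputs"
  shows "nxt X Y (12 * m + 9) = 1" "nxt X Y (12 * m + 10) = 2"
    "12 * m + 11 \<le> v \<Longrightarrow> v < n \<Longrightarrow> nxt X Y v = (if Suc v = n then 0 else Suc v)"
  using m n assms by (auto simp: next_vertex_def twist_last advance_def Suc_mod_eq)

lemma bij_betw_next:
  assumes "X \<in> inputs" "Y \<in> inputs"
  shows "bij_betw (nxt X Y) {..<n} {..<n}"
proof -
have "inj_on (nxt X Y) {..<n}"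
    unfolding next_vertex_def
    by (intro comp_inj_on[of "twist X Y" _ "advance m n", unfolded o_def] inj_on_subset[OF inj_twist]
        inj_on_subset[OF inj_on_advance]) (use twist_less[OF assms] in auto)
  moreover have "nxt X Y ` {..<n} \<subseteq> {..<n}"
    using next_less[OF assms] by auto
  ultimately show ?thesis
    by (simp add: bij_betw_def endo_inj_surj)
qed

text \<open>A step moves one column ahead until the last column, and there are at least 8 columns,
  so two steps cannot close up. This makes the graph simple with all degrees exactly 2.\<close>

lemma next_no_short_cycle:
  assumes "X \<in> inputs" "Y \<in> inputs" "v < n"
  shows "nxt X Y v \<noteq> v" "nxt X Y (nxt X Y v) \<noteq> v"
proof -
  have small: "nxt X Y w < 6" if "w < 3" for w
    using next_div_3[of w X Y] that by simp
  \<comment> \<open>Below 12 * m + 6 both steps are ordinary column steps; from column 4 * m + 2 the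
    second one leaves the last column; the remaining cases start on the last column or the
    padding.\<close>
  consider "v < 12 * m + 6" | "12 * m + 6 \<le> v" "v < 12 * m + 9" | "v = 12 * m + 9" | "v = 12 * m + 10"
    | "12 * m + 11 \<le> v"
    by linarith
  then have "nxt X Y v \<noteq> v \<and> nxt X Y (nxt X Y v) \<noteq> v"
  proof cases
    case 1
    then have "nxt X Y v div 3 = Suc (v div 3)"
      by (intro next_div_3) simp
    moreover from this 1 have "nxt X Y v < 12 * m + 9"
      by (simp only: less_columns)
    then have "nxt X Y (nxt X Y v) div 3 = Suc (nxt X Y v div 3)"
      by (rule next_div_3)
    ultimately show ?thesis
      by (metis n_not_Suc_n Suc_n_not_n less_not_refl2 less_Suc_eq)
  next
    case 2
    define w where "w = nxt X Y v"
    have w: "w div 3 = Suc (v div 3)"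
      using 2 by (simp add: w_def next_div_3)
    then have "w \<ge> 12 * m + 9"
      using 2 by (simp only: less_columns flip: not_less)
    then consider "w = 12 * m + 9" | "w = 12 * m + 10" | "12 * m + 11 \<le> w"
      by linarith
    then have "nxt X Y w \<noteq> v"
    proof cases
      case 3
      moreover have "w < n"
        using assms by (simp add: w_def next_less)
      ultimately show ?thesis
        using next_last(3)[OF assms(1,2) 3] 2 m by auto
    qed (use next_last(1,2)[OF assms(1,2)] 2 m in auto)
    with w show ?thesis
      by (auto simp: w_def)
  next
    case 5
    show ?thesis
    proof (cases "Suc v = n")
      case True
      then have "nxt X Y v = 0"
        using next_last(3)[OF assms(1,2) 5] assms(3) by simp
      with small[of 0] 5 m show ?thesis
        by simp
    next
      case False
      then have "nxt X Y v = Suc v"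
        using next_last(3)[OF assms(1,2) 5] assms(3) by simp
      moreover have "nxt X Y (Suc v) = (if Suc (Suc v) = n then 0 else Suc (Suc v))"
        using 5 False assms by (intro next_last(3)) auto
      ultimately show ?thesis
        using 5 m by simp
    qed
  next
    case 3
    then have "nxt X Y v = 1"
      using next_last(1)[OF assms(1,2)] by simp
    with small[of 1] 3 m show ?thesis
      by simp
  next
    case 4
    then have "nxt X Y v = 2"
      using next_last(2)[OF assms(1,2)] by simp
    with small[of 2] 4 m show ?thesis
      by simp
  qed
  then show "nxt X Y v \<noteq> v" "nxt X Y (nxt X Y v) \<noteq> v"
    by auto
qed

section \<open>The strand invariant and connectivity\<close>

definition sign_at :: "nat set \<Rightarrow> nat \<Rightarrow> int" where
  "sign_at Y i = (if i \<in> Y then -1 else 1)"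

text \<open>
  The track in column 0, modulo 3, from which the walk forward reaches track \<open>r\<close> of column \<open>c\<close>.
\<close>

definition strand :: "nat set \<Rightarrow> nat set \<Rightarrow> nat \<Rightarrow> nat \<Rightarrow> int" where
  "strand X Y c r =
     (if c mod 4 = 3 then sign_at Y (Suc (c div 4)) else sign_at Y (c div 4)) * int r
     - signed_size (X \<inter> {..<if c mod 4 = 0 then c div 4 else Suc (c div 4)}) Y"

lemma signed_size_Suc:
  "signed_size (X \<inter> {..<Suc i}) Y = signed_size (X \<inter> {..<i}) Y + (if i \<in> X then sign_at Y i else 0)"
  by (simp add: signed_size_def sign_at_def lessThan_Suc Int_insert_right)

text \<open>A rotation in block \<open>i\<close> changes the signed track by
  \<open>sign_at Y i\<close>, which the new term of \<open>signed_size\<close> cancels. The merged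
  reflection negates the track modulo 3 exactly when the sign flips between the blocks; this is why
  column 3 of a block already carries the sign of the next one.\<close>

lemma strand_turn:
  assumes "r < 3"
  shows "strand X Y (Suc c) (turn X Y c r) mod 3 = strand X Y c r mod 3"
proof -
  define i where "i = c div 4"
  define S where "S j = signed_size (X \<inter> {..<j}) Y" for j
  have r: "r = 0 \<or> r = 1 \<or> r = 2"
    using assms by linarith
  consider "c mod 4 = 0" "Suc c mod 4 = 1" "Suc c div 4 = i"
    | "c mod 4 = 1" "Suc c mod 4 = 2" "Suc c div 4 = i"
    | "c mod 4 = 2" "Suc c mod 4 = 3" "Suc c div 4 = i"
    | "c mod 4 = 3" "Suc c mod 4 = 0" "Suc c div 4 = Suc i"
  proof -
    have "c mod 4 = 0 \<and> Suc c mod 4 = 1 \<and> Suc c div 4 = i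
        \<or> c mod 4 = 1 \<and> Suc c mod 4 = 2 \<and> Suc c div 4 = i
        \<or> c mod 4 = 2 \<and> Suc c mod 4 = 3 \<and> Suc c div 4 = i
        \<or> c mod 4 = 3 \<and> Suc c mod 4 = 0 \<and> Suc c div 4 = Suc i"
      unfolding i_def by presburger
    with that show thesis by metis
  qed
  then have "3 dvd strand X Y (Suc c) (turn X Y c r) - strand X Y c r"
  proof cases
    case 1
    have S: "S (Suc i) = S i + (if i \<in> X then sign_at Y i else 0)"
      by (simp add: S_def signed_size_Suc)
    have "strand X Y (Suc c) (turn X Y c r) - strand X Y c r
        = sign_at Y i * int (if i \<in> X then (r + 1) mod 3 else r) - S (Suc i) - (sign_at Y i * int r - S i)"
      by (simp only: strand_def turn_def 1 S_def i_def[symmetric]) simp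
    also have "3 dvd \<dots>"
      using r by (auto simp: S sign_at_def)
    finally show ?thesis .
  next
    case 3
    have "strand X Y (Suc c) (turn X Y c r) - strand X Y c r
        = sign_at Y (Suc i) * int (if i \<in> Y \<longleftrightarrow> Suc i \<notin> Y then 2 * r mod 3 else r) - sign_at Y i * int r"
      by (simp only: strand_def turn_def 3 i_def[symmetric]) simp
    also have "3 dvd \<dots>"
      using r by (auto simp: sign_at_def)
    finally show ?thesis .
  next
    case 2
    then show ?thesis
      by (simp only: strand_def turn_def i_def[symmetric]) simp
  next
    case 4
    then show ?thesis
      by (simp only: strand_def turn_def i_def[symmetric]) simp
  qed
  then show ?thesis
    by (simp add: mod_eq_dvd_iff)
qed

lemma strand_next:
  assumes "v < 12 * m + 9"
  shows "strand X Y (nxt X Y v div 3) (nxt X Y v mod 3) mod 3 = strand X Y (v div 3) (v mod 3) mod 3"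
proof -
  have "v div 3 < 4 * m + 3"
    using assms by (simp only: less_columns)
  from next_column[OF this, of "v mod 3" X Y]
  have "nxt X Y v = turn X Y (v div 3) (v mod 3) + 3 * Suc (v div 3)"
    by simp
  moreover have "turn X Y (v div 3) (v mod 3) < 3"
    by (simp add: turn_less)
  ultimately have "nxt X Y v div 3 = Suc (v div 3)" "nxt X Y v mod 3 = turn X Y (v div 3) (v mod 3)"
    using track_coords by blast+
  then show ?thesis
    by (simp add: strand_turn)
qed

lemma strand_first:
  assumes "Y \<in> inputs"
  shows "strand X Y 0 r = int r"
  using assms by (auto simp: strand_def sign_at_def signed_size_def)

text \<open>Since \<open>m + 1\<close> is never in \<open>Y\<close>, the last merged layer restores
  the orientation, and by then every rotation has been counted.\<close>

lemma strand_last: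
  assumes "X \<in> inputs" "Y \<in> inputs"
  shows "strand X Y (4 * m + 3) r = int r - signed_size X Y"
proof -
  have "(4 * m + 3) mod 4 = 3" "Suc ((4 * m + 3) div 4) = Suc m"
    using m by presburger+
  moreover have "X \<inter> {..<Suc m} = X" "Suc m \<notin> Y"
    using assms by auto
  ultimately show ?thesis
    by (simp add: strand_def sign_at_def)
qed

lemma column_cases:
  obtains "v < 12 * m + 9" | "v = 12 * m + 9" | "v = 12 * m + 10" | "v \<ge> 12 * m + 11"
  by linarith

lemma last_column_coords:
  "(12 * m + 9) div 3 = 4 * m + 3" "(12 * m + 9) mod 3 = 0"
  "(12 * m + 10) div 3 = 4 * m + 3" "(12 * m + 10) mod 3 = 1"
  "(12 * m + 11) div 3 = 4 * m + 3" "(12 * m + 11) mod 3 = 2"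
  using m by presburger+

text \<open>A strand leaving on track \<open>s\<close> returns on track
  \<open>s + signed_size X Y + 1\<close> modulo 3. A rotation of three tracks is transitive iff it
  is not the identity.\<close>

lemma connected_strands:
  assumes XY: "X \<in> inputs" "Y \<in> inputs"
  shows "Digraph_Component.connected (functional_graph n (nxt X Y)) \<longleftrightarrow> \<not> 3 dvd 1 + signed_size X Y"
proof -
  have n0: "n > 0"
    using m n by linarith
  have conn: "Digraph_Component.connected (functional_graph n (nxt X Y))
      \<longleftrightarrow> (\<forall>Q. Q 0 \<longrightarrow> (\<forall>v<n. Q v \<longleftrightarrow> Q (nxt X Y v)) \<longrightarrow> (\<forall>v<n. Q v))"
    using n0 by (intro connected_functional_graph next_less next_no_short_cycle XY) auto
  show ?thesis
  proof
    assume *: "Digraph_Component.connected (functional_graph n (nxt X Y))"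
    show "\<not> 3 dvd 1 + signed_size X Y"
    proof
      assume dvd: "3 dvd 1 + signed_size X Y"
      \<comment> \<open>The component of vertex 0: the strand starting there, together with the
        padding, which leads back to 0.\<close>
      define Q where "Q v \<longleftrightarrow> v \<ge> 12 * m + 11 \<or> strand X Y (v div 3) (v mod 3) mod 3 = 0" for v
      have "Q v \<longleftrightarrow> Q (nxt X Y v)" if "v < n" for v
      proof (cases v rule: column_cases)
        case 1
        \<comment> \<open>Vertex 12 * m + 11 satisfies the first disjunct of \<open>Q\<close> by
          fiat; divisibility makes it satisfy the second as well, so the two descriptions agree
          where they meet.\<close>
        have "strand X Y ((12 * m + 11) div 3) ((12 * m + 11) mod 3) mod 3 = 0"
          unfolding last_column_coords strand_last[OF XY] using dvd by presburger
        moreover have "nxt X Y v < 12 * m + 12"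
          using next_div_3[OF 1, of X Y] 1 by (simp only: less_columns)
        then have "nxt X Y v \<ge> 12 * m + 11 \<Longrightarrow> nxt X Y v = 12 * m + 11"
          by linarith
        ultimately have "Q (nxt X Y v) \<longleftrightarrow> strand X Y (nxt X Y v div 3) (nxt X Y v mod 3) mod 3 = 0"
          unfolding Q_def by metis
        then show ?thesis
          using 1 strand_next[OF 1, of X Y] by (simp add: Q_def)
      next
        case 2
        have "Q v \<longleftrightarrow> (0 - signed_size X Y) mod 3 = 0"
          using strand_last[OF XY, of 0] by (simp add: 2 Q_def last_column_coords)
        moreover have "\<not> Q 1"
          using m by (simp add: Q_def strand_first[OF XY(2)])
        moreover have "(0 - signed_size X Y) mod 3 \<noteq> 0"
          using dvd by presburger
        ultimately show ?thesis
          using 2 next_last(1)[OF XY] by simp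
      next
        case 3
        have "Q v \<longleftrightarrow> (1 - signed_size X Y) mod 3 = 0"
          using strand_last[OF XY, of 1] by (simp add: 3 Q_def last_column_coords)
        moreover have "\<not> Q 2"
          using m by (simp add: Q_def strand_first[OF XY(2)])
        moreover have "(1 - signed_size X Y) mod 3 \<noteq> 0"
          using dvd by presburger
        ultimately show ?thesis
          using 3 next_last(2)[OF XY] by simp
      next
        case 4
        then show ?thesis
          using next_last(3)[OF XY 4 that] by (simp add: Q_def strand_first[OF XY(2)])
      qed
      moreover have "Q 0" "\<not> Q 1" "1 < n"
        using m n by (simp_all add: Q_def strand_first[OF XY(2)])
      ultimately show False
        using * conn by blast
    qed
  next
    assume ndvd: "\<not> 3 dvd 1 + signed_size X Y"
    show "Digraph_Component.connected (functional_graph n (nxt X Y))"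
      unfolding conn
    proof (intro allI impI)
      fix Q v assume Q0: "Q 0" and closed: "\<forall>v<n. Q v \<longleftrightarrow> Q (nxt X Y v)" and "v < n"
      \<comment> \<open>Every vertex in the columns shares its \<open>Q\<close> value with the start
        of its strand, one of the vertices 0, 1, 2. So only \<open>Q 1\<close> and
        \<open>Q 2\<close> remain to be shown.\<close>
      have col: "Q (3 * c + r) \<longleftrightarrow> Q (nat (strand X Y c r mod 3))" if "c < 4 * m + 4" "r < 3" for c r
        using that
      proof (induction c arbitrary: r)
        case 0
        then show ?case
          by (simp add: strand_first[OF XY(2)])
      next
        case (Suc c)
        obtain r' where r': "r' < 3" "turn X Y c r' = r"
          using turn_surj[OF \<open>r < 3\<close>] .
        have "3 * c + r' < n"
          using Suc.prems r' n by linarith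
        then have "Q (3 * c + r') \<longleftrightarrow> Q (3 * Suc c + r)"
          using closed next_column[of c r' X Y] Suc.prems r' by auto
        moreover have "Q (3 * c + r') \<longleftrightarrow> Q (nat (strand X Y c r' mod 3))"
          using Suc r' by simp
        ultimately show ?case
          using strand_turn[OF r'(1), of X Y c] r'(2) by (metis (no_types))
      qed
      have pad: "Q w" if "12 * m + 11 \<le> w" "w < n" for w
        using that
      \<comment> \<open>The padding path ends at 0, so \<open>Q\<close> spreads backwards from its
        end.\<close>
      proof (induction "n - w" arbitrary: w)
        case (Suc d)
        show ?case
        proof (cases "Suc w = n")
          case True
          then show ?thesis
            using closed Q0 next_last(3)[OF XY Suc.prems] Suc.prems by auto
        next
          case False
          then have "Q (Suc w)"
            using Suc by (intro Suc.hyps(1)) auto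
          then show ?thesis
            using closed False next_last(3)[OF XY Suc.prems] Suc.prems by auto
        qed
      qed auto
      have last: "Q (nat ((int r - signed_size X Y) mod 3)) \<longleftrightarrow> Q (12 * m + 9 + r)" if "r < 3" for r
      proof -
        have "3 * (4 * m + 3) + r = 12 * m + 9 + r"
          by simp
        then show ?thesis
          using col[OF _ that, of "4 * m + 3"] strand_last[OF XY, of r] by simp
      qed
      have "Q (12 * m + 11)"
        using pad[of "12 * m + 11"] m n by linarith
      then have "Q (nat ((2 - signed_size X Y) mod 3))"
        using last[of 2] by (simp add: add.commute)
      moreover have "Q (12 * m + 10) \<longleftrightarrow> Q 2" "Q (12 * m + 9) \<longleftrightarrow> Q 1"
        using closed[rule_format, of "12 * m + 10"] closed[rule_format, of "12 * m + 9"]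
          next_last(1,2)[OF XY] n by simp_all
      then have "Q (nat ((1 - signed_size X Y) mod 3)) \<longleftrightarrow> Q 2"
        "Q (nat ((0 - signed_size X Y) mod 3)) \<longleftrightarrow> Q 1"
        using last[of 1] last[of 0] by (simp_all add: add.commute)
      \<comment> \<open>Residue 2 is excluded by \<open>ndvd\<close>. In either other case track 2
        of the last column gives one of \<open>Q 1\<close>, \<open>Q 2\<close>, and a second strand
        links it to the other.\<close>
      moreover have "signed_size X Y mod 3 = 0 \<or> signed_size X Y mod 3 = 1"
        using ndvd by presburger
      ultimately have Q12: "Q 1 \<and> Q 2"
      proof (elim disjE)
        assume "signed_size X Y mod 3 = 0"
        then have "(2 - signed_size X Y) mod 3 = 2" "(1 - signed_size X Y) mod 3 = 1"
          by presburger+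
        moreover assume "Q (nat ((2 - signed_size X Y) mod 3))"
          "Q (nat ((1 - signed_size X Y) mod 3)) \<longleftrightarrow> Q 2"
        ultimately show ?thesis by simp
      next
        assume "signed_size X Y mod 3 = 1"
        then have "(2 - signed_size X Y) mod 3 = 1" "(0 - signed_size X Y) mod 3 = 2"
          by presburger+
        moreover assume "Q (nat ((2 - signed_size X Y) mod 3))"
          "Q (nat ((0 - signed_size X Y) mod 3)) \<longleftrightarrow> Q 1"
        ultimately show ?thesis by simp
      qed
      show "Q v"
      proof (cases "v < 12 * m + 12")
        case True
        define z where "z = nat (strand X Y (v div 3) (v mod 3) mod 3)"
        have "z < 3"
          unfolding z_def by linarith
        then have "Q z"
          using Q0 Q12 less_3_cases[of z] by auto
        moreover have "v div 3 < 4 * m + 4"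
          using True by (simp only: less_columns)
        ultimately show ?thesis
          using col[of "v div 3" "v mod 3"] by (simp add: z_def)
      next
        case False
        then show ?thesis
          using pad \<open>v < n\<close> by simp
      qed
    qed
  qed
qed

end

section \<open>Streams of the two players\<close>

text \<open>Sorting fixes the order inside the list, so equal neighbourhoods give literally equal
  stream entries.\<close>

definition entry :: "nat \<Rightarrow> (nat \<Rightarrow> nat) \<Rightarrow> nat \<Rightarrow> al_entry" where
  "entry n f v = (v, map (Pair v) (sorted_list_of_set {w. w < n \<and> (w = f v \<or> v = f w)}))"

lemma al_stream_functional_graph:
  assumes "distinct vs" "set vs = {..<n}"
  shows "al_stream (functional_graph n f) (map (entry n f) vs)"
proof -
  have fst: "map fst (map (entry n f) vs) = vs"
    by (simp add: entry_def comp_def)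
  have list: "distinct es \<and> set es = out_arcs (functional_graph n f) v"
    if es: "(v, es) \<in> set (map (entry n f) vs)" for v es
  proof -
    from es assms(2) have v: "v < n"
      and es: "es = map (Pair v) (sorted_list_of_set {w. w < n \<and> (w = f v \<or> v = f w)})"
      by (auto simp: entry_def)
    have "set es = Pair v ` {w. w < n \<and> (w = f v \<or> v = f w)}"
      by (simp add: es)
    also have "\<dots> = out_arcs (functional_graph n f) v"
      using v by (auto simp: out_arcs_def)
    finally show ?thesis
      by (simp add: es distinct_map inj_on_def)
  qed
  show ?thesis
    unfolding al_stream_def
  proof (intro conjI ballI)
    show "distinct (map fst (map (entry n f) vs))"
      "set (map fst (map (entry n f) vs)) = verts (functional_graph n f)"
      unfolding fst using assms by simp_all
    fix z assume "z \<in> set (map (entry n f) vs)"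
    then show "case z of (v, es) \<Rightarrow> distinct es \<and> set es = out_arcs (functional_graph n f) v"
      using list[of "fst z" "snd z"] by (simp add: case_prod_unfold)
  qed
qed

section \<open>Splitting the stream between the players\<close>

context strands
begin

text \<open>Edges depending on \<open>X\<close> join columns 0 and 1 of a block, those depending on
  \<open>Y\<close> columns 2 and 3; edges between the players are fixed. The padding goes to
  Alice.\<close>

definition alice :: "nat \<Rightarrow> bool" where
  "alice v \<longleftrightarrow> v div 3 mod 4 < 2 \<or> v \<ge> 12 * m + 12"

text \<open>
  The other player's set is replaced by the empty one in the two parts of the stream, on which it has no influence.
\<close>

definition alice_part :: "nat set \<Rightarrow> al_entry list" where
  "alice_part X = map (entry n (nxt X {})) (filter alice [0..<n])"

definition bob_part :: "nat set \<Rightarrow> al_entry list" where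
  "bob_part Y = map (entry n (nxt {} Y)) (filter (\<lambda>v. \<not> alice v) [0..<n])"

lemma next_cong:
  assumes "X \<in> inputs" "Y \<in> inputs" "X' \<in> inputs" "Y' \<in> inputs"
    and "v \<ge> 12 * m + 12 \<or> (v div 3 mod 4 = 0 \<longrightarrow> X = X') \<and> (v div 3 mod 4 = 2 \<longrightarrow> Y = Y')"
  shows "nxt X Y v = nxt X' Y' v"
proof (cases "v \<ge> 12 * m + 12")
  case True
  then have "v \<ge> 12 * m + 9"
    by simp
  then show ?thesis
    by (simp only: next_vertex_def twist_last[OF assms(1,2)] twist_last[OF assms(3,4)])
next
  case False
  then show ?thesis
    using assms(5) by (auto simp: next_vertex_def twist_def turn_def)
qed

lemma alice_next:
  assumes "v < 12 * m + 9"
  shows "alice (nxt X Y v) \<longleftrightarrow> v div 3 mod 4 = 0 \<or> v div 3 mod 4 = 3"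
proof -
  have "nxt X Y v div 3 = Suc (v div 3)"
    using assms by (rule next_div_3)
  moreover from this assms have "nxt X Y v < 12 * m + 12"
    by (simp only: less_columns)
  moreover have "Suc c mod 4 < 2 \<longleftrightarrow> c mod 4 = 0 \<or> c mod 4 = 3" for c
    by presburger
  ultimately have "nxt X Y v < 12 * m + 12" "nxt X Y v div 3 mod 4 < 2 \<longleftrightarrow> v div 3 mod 4 = 0 \<or> v div 3 mod 4 = 3"
    by simp_all
  then show ?thesis
    by (simp add: alice_def)
qed

lemma not_last_column:
  assumes "v < 12 * m + 12" "v div 3 mod 4 \<noteq> 3"
  shows "v < 12 * m + 9"
proof -
  have "(4 * m + 3) mod 4 = 3"
    by presburger
  then have "v div 3 \<noteq> 4 * m + 3"
    using assms(2) by metis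
  with assms(1) show ?thesis
    unfolding less_columns by linarith
qed

lemma entry_cong:
  assumes "\<And>w. w = f v \<or> v = f w \<longleftrightarrow> w = f' v \<or> v = f' w"
  shows "entry n f v = entry n f' v"
  by (simp only: entry_def assms)

text \<open>\<open>Y\<close> influences only the successors of column 2 of a block, and these lie in
  Bob's column 3. So neither the successor nor the predecessors of a vertex of Alice depend on
  \<open>Y\<close>.\<close>

lemma entry_alice:
  assumes "X \<in> inputs" "Y \<in> inputs" "alice v"
  shows "entry n (nxt X {}) v = entry n (nxt X Y) v"
proof (rule entry_cong)
  fix w
  have "nxt X {} v = nxt X Y v"
    using assms by (intro next_cong) (auto simp: alice_def)
  moreover have "v = nxt X {} w \<longleftrightarrow> v = nxt X Y w"
  proof (cases "w \<ge> 12 * m + 12 \<or> w div 3 mod 4 \<noteq> 2")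
    case True
    then have "nxt X {} w = nxt X Y w"
      using assms by (intro next_cong) auto
    then show ?thesis
      by simp
  next
    case False
    then have "w < 12 * m + 9"
      by (intro not_last_column) auto
    from alice_next[OF this] False assms(3) show ?thesis
      by auto
  qed
  ultimately show "w = nxt X {} v \<or> v = nxt X {} w \<longleftrightarrow> w = nxt X Y v \<or> v = nxt X Y w"
    by simp
qed

lemma entry_bob:
  assumes "X \<in> inputs" "Y \<in> inputs" "\<not> alice v"
  shows "entry n (nxt {} Y) v = entry n (nxt X Y) v"
proof (rule entry_cong)
  fix w
  have "nxt {} Y v = nxt X Y v"
    using assms by (intro next_cong) (auto simp: alice_def)
  moreover have "v = nxt {} Y w \<longleftrightarrow> v = nxt X Y w"
  proof (cases "w \<ge> 12 * m + 12 \<or> w div 3 mod 4 \<noteq> 0")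
    case True
    then have "nxt {} Y w = nxt X Y w"
      using assms by (intro next_cong) auto
    then show ?thesis
      by simp
  next
    case False
    then have "w < 12 * m + 9"
      by (intro not_last_column) auto
    from alice_next[OF this] False assms(3) show ?thesis
      by auto
  qed
  ultimately show "w = nxt {} Y v \<or> v = nxt {} Y w \<longleftrightarrow> w = nxt X Y v \<or> v = nxt X Y w"
    by simp
qed

lemma al_stream_parts:
  assumes "X \<in> inputs" "Y \<in> inputs"
  shows "al_stream (functional_graph n (nxt X Y)) (alice_part X @ bob_part Y)"
proof -
  have "alice_part X @ bob_part Y
      = map (entry n (nxt X Y)) (filter alice [0..<n] @ filter (\<lambda>v. \<not> alice v) [0..<n])"
    by (simp add: alice_part_def bob_part_def entry_alice[OF assms] entry_bob[OF assms])
  moreover have "al_stream (functional_graph n (nxt X Y)) \<dots>"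
    by (rule al_stream_functional_graph) auto
  ultimately show ?thesis
    by simp
qed

text \<open>The handover times are thus the same for all inputs, so that memory states can be
  compared across inputs.\<close>

lemma length_parts:
  "length (alice_part X) = length (alice_part {})" "length (bob_part Y) = length (bob_part {})"
  by (simp_all add: alice_part_def bob_part_def)

lemma parts_nonempty: "alice_part X \<noteq> []" "bob_part Y \<noteq> []"
proof -
  \<comment> \<open>Vertex 6 is track 0 of column 2, the first column of Bob.\<close>
  have "0 \<in> set (filter alice [0..<n])" "6 \<in> set (filter (\<lambda>v. \<not> alice v) [0..<n])"
    using m n by (simp_all add: alice_def)
  then have "filter alice [0..<n] \<noteq> []" "filter (\<lambda>v. \<not> alice v) [0..<n] \<noteq> []"
    by (metis empty_iff empty_set)+
  then show "alice_part X \<noteq> []" "bob_part Y \<noteq> []"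
    by (simp_all only: alice_part_def bob_part_def map_is_Nil_conv not_False_eq_True)
qed

lemma graph_of_inputs:
  assumes "X \<in> inputs" "Y \<in> inputs"
  shows "n_vertex_graph n (functional_graph n (nxt X Y))" "max_degree (functional_graph n (nxt X Y)) = 2"
proof -
  show "n_vertex_graph n (functional_graph n (nxt X Y))"
    unfolding n_vertex_graph_def
    by (simp add: pair_graph_functional_graph next_no_short_cycle(1)[OF assms])
  show "max_degree (functional_graph n (nxt X Y)) = 2"
    using n by (intro max_degree_functional_graph bij_betw_next next_no_short_cycle(2) assms) auto
qed

end

section \<open>Algorithms and rectangles\<close>

text \<open>
  The times at which one player, with \<open>a\<close> or \<open>b\<close> entries in each pass, hands the memory over to the other.
\<close>

definition boundary_times :: "nat \<Rightarrow> nat \<Rightarrow> nat \<Rightarrow> nat set" where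
  "boundary_times p a b = (\<lambda>j. j * (a + b) + a) ` {..<p} \<union> (\<lambda>j. Suc j * (a + b)) ` {..<p}"

lemma finite_boundary_times [simp]: "finite (boundary_times p a b)"
  by (simp add: boundary_times_def)

lemma card_boundary_times: "card (boundary_times p a b) \<le> 2 * p"
proof -
  have "card (boundary_times p a b) \<le> p + p"
    unfolding boundary_times_def
    by (intro order_trans[OF card_Un_le] add_mono order_trans[OF card_image_le]) auto
  then show ?thesis
    by simp
qed

lemma boundary_times_le:
  assumes "t \<in> boundary_times p a b"
  shows "t \<le> p * (a + b)"
proof -
  from assms obtain j where "j < p" "t \<le> Suc j * (a + b)"
    by (auto simp: boundary_times_def)
  then show ?thesis
    by (meson Suc_leI le_trans mult_le_mono1)
qed

text \<open>Cut and paste: on the mixed input the memory follows the run on \<open>x\<close>,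
  \<open>y\<close> while Alice reads and the run on \<open>x'\<close>, \<open>y'\<close> while Bob
  reads. Agreement at the handovers allows switching between them.\<close>

lemma memory_at_crossing:
  fixes al :: "'x \<Rightarrow> al_entry list" and bob :: "'y \<Rightarrow> al_entry list"
  assumes al: "\<And>x. length (al x) = a" and bob: "\<And>y. length (bob y) = b" and pos: "a > 0" "b > 0"
    and agree: "\<And>t. t \<in> boundary_times p a b \<Longrightarrow>
      memory_at A (al x @ bob y) t = memory_at A (al x' @ bob y') t"
    and t: "t \<in> boundary_times p a b"
  shows "memory_at A (al x @ bob y') t = memory_at A (al x @ bob y) t"
proof -
  let ?L = "a + b"
  have inv: "memory_at A (al x @ bob y') t =
      (if t mod ?L < a then memory_at A (al x @ bob y) t else memory_at A (al x' @ bob y') t)"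
    if "t \<le> p * ?L" for t
    using that
  proof (induction t)
    case 0
    then show ?case by (simp add: pos)
  next
    case (Suc t)
    define j r where "j = t div ?L" and "r = t mod ?L"
    have t: "t = j * ?L + r"
      by (simp only: j_def r_def div_mult_mod_eq)
    have r: "r < ?L"
      using pos by (simp add: r_def)
    have "j * ?L < p * ?L"
      using Suc.prems t by linarith
    then have j: "j < p"
      by simp
    have IH: "memory_at A (al x @ bob y') t =
      (if r < a then memory_at A (al x @ bob y) t else memory_at A (al x' @ bob y') t)"
      using Suc by (simp add: r_def)
    have step: "memory_at A (al x @ bob y') (Suc t) =
      (if r < a then memory_at A (al x @ bob y) (Suc t) else memory_at A (al x' @ bob y') (Suc t))"
      using IH by (auto simp: al bob nth_append r_def[symmetric])
    \<comment> \<open>The second and fourth cases are the handovers, within a pass and at its end;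
      only there does the run being followed change and \<open>agree\<close> enter.\<close>
    consider "Suc r < a" | "Suc r = a" | "a \<le> r" "Suc r < ?L" | "a \<le> r" "Suc r = ?L"
      using r by linarith
    then show ?case
    proof cases
      case 1
      then have "Suc t mod ?L = Suc r"
        by (simp add: t mod_Suc)
      with 1 step show ?thesis by simp
    next
      case 2
      then have mod: "Suc t mod ?L = a"
        using pos by (simp add: t mod_Suc)
      have "Suc t = j * ?L + a"
        using t 2 by simp
      then have "Suc t \<in> boundary_times p a b"
        using j by (auto simp: boundary_times_def)
      with 2 step mod agree show ?thesis by (simp del: memory_at.simps)
    next
      case 3
      then have "Suc t mod ?L = Suc r"
        by (simp add: t mod_Suc)
      with 3 step show ?thesis by simp
    next
      case 4
      then have mod: "Suc t mod ?L = 0"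
        by (simp add: t mod_Suc)
      have "Suc t = Suc j * ?L"
        using t 4 by simp
      then have "Suc t \<in> boundary_times p a b"
        using j by (auto simp: boundary_times_def)
      with 4 step mod agree pos show ?thesis by (simp del: memory_at.simps)
    qed
  qed
  show ?thesis
    using inv[OF boundary_times_le[OF t]] agree[OF t] by simp
qed

text \<open>The exact count is 2 ^ (s + 1) - 1. The bound \<open>4 ^ s\<close> is still 1 at
  \<open>s = 0\<close>, which avoids a factor exponential in \<open>p\<close> when counting
  transcripts.\<close>

lemma card_bool_lists_le: "card {w :: bool list. length w \<le> s} \<le> 4 ^ s"
proof -
  have "{w :: bool list. length w \<le> s} = {w. set w \<subseteq> UNIV \<and> length w \<le> s}"
    by simp
  then have "card {w :: bool list. length w \<le> s} = (\<Sum>i\<le>s. 2 ^ i)"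
    by (simp only: card_lists_length_le[OF finite] card_UNIV_bool)
  also have "\<dots> \<le> 4 ^ s"
  proof (induction s)
    case (Suc s)
    have "(2::nat) ^ Suc s \<le> 2 * 4 ^ s"
      using power_mono[of 2 "4::nat" s] by simp
    with Suc show ?case by simp
  qed simp
  finally show ?thesis .
qed

lemma finite_bool_lists_le: "finite {w :: bool list. length w \<le> s}"
  using finite_lists_length_le[OF finite, of UNIV s] by simp

text \<open>The states at the handovers form a transcript with at most
  \<open>4 ^ (2 * p * s)\<close> values. Inputs with a common transcript form a rectangle with a
  constant answer, which contributes at most \<open>M\<close>.\<close>

lemma algorithm_correlation_le:
  fixes al :: "'x \<Rightarrow> al_entry list" and bob :: "'y \<Rightarrow> al_entry list" and g :: "'x \<Rightarrow> 'y \<Rightarrow> real"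
  assumes al: "\<And>x. length (al x) = a" and bob: "\<And>y. length (bob y) = b" and pos: "a > 0" "b > 0"
    and p: "p \<ge> 1" and fin: "finite U" "finite V"
    and rect: "\<And>U' V'. U' \<subseteq> U \<Longrightarrow> V' \<subseteq> V \<Longrightarrow> \<bar>\<Sum>x\<in>U'. \<Sum>y\<in>V'. g x y\<bar> \<le> M"
    and bits: "\<And>x y. x \<in> U \<Longrightarrow> y \<in> V \<Longrightarrow> bits_used A p (al x @ bob y) \<le> s"
  shows "(\<Sum>z\<in>U \<times> V. g (fst z) (snd z) * (if accepts A p (al (fst z) @ bob (snd z)) then -1 else 1))
      \<le> 4 ^ (2 * p * s) * M"
proof -
  define B where "B = boundary_times p a b"
  define T where "T z = restrict (memory_at A (al (fst z) @ bob (snd z))) B" for z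
  define R where "R = B \<rightarrow>\<^sub>E {w :: bool list. length w \<le> s}"
  let ?f = "\<lambda>z. g (fst z) (snd z) * (if accepts A p (al (fst z) @ bob (snd z)) then -1 else 1)"
  have M: "M \<ge> 0"
    using rect[of "{}" "{}"] by simp
  \<comment> \<open>The end of the last pass is itself a handover, so the transcript determines the
    answer.\<close>
  have "p * (a + b) \<in> B"
    using p unfolding B_def boundary_times_def
    by (intro UnI2 image_eqI[of _ _ "p - 1"]) auto
  then have acc: "accepts A p (al (fst z) @ bob (snd z)) \<longleftrightarrow> answer A (T z (p * (a + b)))" for z
    by (simp add: accepts_def T_def al bob)
  have "T ` (U \<times> V) \<subseteq> R"
  proof (rule image_subsetI)
    fix z assume "z \<in> U \<times> V"
    then have le: "bits_used A p (al (fst z) @ bob (snd z)) \<le> s"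
      using bits by auto
    have "length (memory_at A (al (fst z) @ bob (snd z)) t) \<le> s" if "t \<in> B" for t
    proof -
      have "t \<le> p * length (al (fst z) @ bob (snd z))"
        using boundary_times_le that by (simp add: B_def al bob)
      then have "length (memory_at A (al (fst z) @ bob (snd z)) t) \<le> bits_used A p (al (fst z) @ bob (snd z))"
        unfolding bits_used_def by (intro Max_ge) auto
      with le show ?thesis by simp
    qed
    then show "T z \<in> R"
      by (auto simp: T_def R_def)
  qed
  have class_le: "(\<Sum>z\<in>{z \<in> U \<times> V. T z = \<tau>}. ?f z) \<le> M" for \<tau>
  proof -
    define C where "C = {z \<in> U \<times> V. T z = \<tau>}"
    \<comment> \<open>Two inputs with equal transcripts can be crossed, and the mixed pair keeps
      that transcript.\<close>
    have C: "C = fst ` C \<times> snd ` C"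
    proof (intro equalityI subsetI)
      fix z assume "z \<in> fst ` C \<times> snd ` C"
      then obtain y x' where z: "(fst z, y) \<in> C" "(x', snd z) \<in> C"
        by force
      then have "T (fst z, y) = T (x', snd z)"
        by (simp add: C_def)
      then have "memory_at A (al (fst z) @ bob y) t = memory_at A (al x' @ bob (snd z)) t" if "t \<in> B" for t
        using that by (metis T_def fst_conv snd_conv restrict_apply')
      then have "memory_at A (al (fst z) @ bob (snd z)) t = memory_at A (al (fst z) @ bob y) t" if "t \<in> B" for t
        using that unfolding B_def
        by (rule memory_at_crossing[of al a bob b p A "fst z" y x' "snd z" t, OF al bob pos])
      then have "T z = T (fst z, y)"
        by (auto simp: T_def restrict_def)
      with z show "z \<in> C"
        by (cases z) (auto simp: C_def)
    qed force
    have sub: "fst ` C \<subseteq> U" "snd ` C \<subseteq> V"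
      by (auto simp: C_def)
    have "(\<Sum>z\<in>C. ?f z) = (\<Sum>z\<in>C. g (fst z) (snd z)) * (if answer A (\<tau> (p * (a + b))) then -1 else 1)"
      unfolding sum_distrib_right acc by (intro sum.cong) (auto simp: C_def)
    also have "\<dots> \<le> \<bar>\<Sum>z\<in>C. g (fst z) (snd z)\<bar>"
      by auto
    also have "(\<Sum>z\<in>C. g (fst z) (snd z)) = (\<Sum>x\<in>fst ` C. \<Sum>y\<in>snd ` C. g x y)"
      by (subst C) (simp add: sum.cartesian_product case_prod_beta)
    also have "\<bar>\<dots>\<bar> \<le> M"
      by (rule rect[OF sub])
    finally show ?thesis
      by (simp add: C_def)
  qed
  have finR: "finite R"
    unfolding R_def by (intro finite_PiE finite_bool_lists_le) (simp add: B_def)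
  have "card R = card {w :: bool list. length w \<le> s} ^ card B"
    unfolding R_def by (subst card_PiE) (auto simp: B_def)
  also have "\<dots> \<le> (4 ^ s) ^ card B"
    by (intro power_mono card_bool_lists_le) simp
  also have "\<dots> \<le> (4 ^ s) ^ (2 * p)"
    by (intro power_increasing) (auto simp: B_def card_boundary_times)
  also have "\<dots> = 4 ^ (2 * p * s)"
    by (simp add: power_mult[symmetric] mult.commute)
  finally have cardR: "real (card R) \<le> 4 ^ (2 * p * s)"
    by (metis of_nat_le_iff of_nat_numeral of_nat_power)
  have "(\<Sum>z\<in>U \<times> V. ?f z) = (\<Sum>\<tau>\<in>R. \<Sum>z\<in>{z \<in> U \<times> V. T z = \<tau>}. ?f z)"
    using fin finR \<open>T ` (U \<times> V) \<subseteq> R\<close> by (intro sum.group[symmetric]) auto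
  also have "\<dots> \<le> (\<Sum>\<tau>\<in>R. M)"
    by (intro sum_mono class_le)
  also have "\<dots> \<le> 4 ^ (2 * p * s) * M"
    using cardR M by (simp add: mult_right_mono)
  finally show ?thesis .
qed

text \<open>Success probability 2/3 means an expected sign of at least 1/3 on each input. Exchanging
  expectation and weighted sum bounds a third of the total weight by the best correlation in the
  support.\<close>

lemma averaging_bound:
  fixes w :: "'z \<Rightarrow> real" and D :: "'a pmf"
  assumes fin: "finite Z" and w: "\<And>z. z \<in> Z \<Longrightarrow> w z \<ge> 0"
    and prob: "\<And>z. z \<in> Z \<Longrightarrow> measure_pmf.prob D {A. good A z} \<ge> 2 / 3"
    and bound: "\<And>A. A \<in> set_pmf D \<Longrightarrow> (\<Sum>z\<in>Z. w z * (if good A z then 1 else -1)) \<le> M"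
  shows "(\<Sum>z\<in>Z. w z) \<le> 3 * M"
proof -
  let ?f = "\<lambda>A. \<Sum>z\<in>Z. w z * (2 * indicator {A. good A z} A - 1)"
  have int2: "integrable (measure_pmf D) (\<lambda>A. 2 * indicator {A. good A z} A :: real)" for z
    by (rule measure_pmf.integrable_const_bound[where B = 2]) (auto simp: indicator_def)
  have int: "integrable (measure_pmf D) (\<lambda>A. w z * (2 * indicator {A. good A z} A - 1))" for z
    by (intro integrable_mult_right Bochner_Integration.integrable_diff int2 measure_pmf.integrable_const)
  have "?f A = (\<Sum>z\<in>Z. w z * (if good A z then 1 else -1))" for A
    by (intro sum.cong) auto
  then have "?f A \<le> M" if "A \<in> set_pmf D" for A
    using bound[OF that] by simp
  then have "measure_pmf.expectation D ?f \<le> M"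
    by (intro measure_pmf.integral_le_const Bochner_Integration.integrable_sum int)
      (simp add: AE_measure_pmf_iff)
  moreover have "measure_pmf.expectation D ?f = (\<Sum>z\<in>Z. w z * (2 * measure_pmf.prob D {A. good A z} - 1))"
    unfolding Bochner_Integration.integral_sum[OF int]
    by (subst integral_mult_right_zero, subst Bochner_Integration.integral_diff[OF int2 measure_pmf.integrable_const]) simp
  moreover have "(\<Sum>z\<in>Z. w z * (1 / 3)) \<le> (\<Sum>z\<in>Z. w z * (2 * measure_pmf.prob D {A. good A z} - 1))"
    using w prob by (intro sum_mono mult_left_mono) force+
  ultimately show ?thesis
    by (simp add: sum_divide_distrib[symmetric])
qed

section \<open>The lower bound\<close>

lemma sum_abs_gap_ge:
  assumes "finite I"
  shows "4 ^ card I \<le> (\<Sum>z\<in>Pow I \<times> Pow I. \<bar>gap (fst z) (snd z)\<bar>)"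
proof -
  have "(4::real) ^ card I = (\<Sum>z\<in>Pow I \<times> Pow I. 1)"
    by (simp add: card_Pow[OF assms] card_cartesian_product power_mult_distrib[symmetric])
  also have "\<dots> \<le> (\<Sum>z\<in>Pow I \<times> Pow I. \<bar>gap (fst z) (snd z)\<bar>)"
    by (intro sum_mono) (simp add: gap_def)
  finally show ?thesis .
qed

text \<open>With weights \<open>\<bar>gap\<bar> \<ge> 1\<close> the total weight is at least
  \<open>4 ^ m\<close>. The constant 6 is the 3 of the averaging times the 2 of the rectangle
  bound.\<close>

lemma (in strands) memory_lower_bound:
  assumes p: "p \<ge> 1"
    and correct: "\<And>X Y. X \<in> inputs \<Longrightarrow> Y \<in> inputs \<Longrightarrow>
      measure_pmf.prob D {A. accepts A p (alice_part X @ bob_part Y)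
        \<longleftrightarrow> Digraph_Component.connected (functional_graph n (nxt X Y))} \<ge> 2 / 3"
    and bits: "\<And>X Y A. X \<in> inputs \<Longrightarrow> Y \<in> inputs \<Longrightarrow> A \<in> set_pmf D \<Longrightarrow>
      bits_used A p (alice_part X @ bob_part Y) \<le> s"
  shows "4 ^ m \<le> 6 * 4 ^ (2 * p * s) * sqrt 12 ^ m"
proof -
  let ?I = "{1..m}" and ?Z = "inputs \<times> inputs"
  let ?\<sigma> = "\<lambda>z. alice_part (fst z) @ bob_part (snd z)"
  let ?g = "\<lambda>z. gap (fst z) (snd z)"
  let ?good = "\<lambda>A z. accepts A p (?\<sigma> z) \<longleftrightarrow> ?g z < 0"
  have conn: "Digraph_Component.connected (functional_graph n (nxt X Y)) \<longleftrightarrow> gap X Y < 0"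
    if "X \<in> inputs" "Y \<in> inputs" for X Y
    using connected_strands[OF that] by (simp add: gap_def)
  have "(\<Sum>z\<in>?Z. \<bar>?g z\<bar>) \<le> 3 * (4 ^ (2 * p * s) * (2 * sqrt 12 ^ card ?I))"
  proof (rule averaging_bound)
    show "measure_pmf.prob D {A. ?good A z} \<ge> 2 / 3" if "z \<in> ?Z" for z
      using that correct[of "fst z" "snd z"] conn[of "fst z" "snd z"] by auto
    show "(\<Sum>z\<in>?Z. \<bar>?g z\<bar> * (if ?good A z then 1 else - 1)) \<le> 4 ^ (2 * p * s) * (2 * sqrt 12 ^ card ?I)"
      if A: "A \<in> set_pmf D" for A
    proof -
      \<comment> \<open>Correctness compares the answer with the sign of \<open>gap\<close>, so the
        two signs combine into one that depends on the answer alone.\<close>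
      have "(\<Sum>z\<in>?Z. \<bar>?g z\<bar> * (if ?good A z then 1 else - 1))
          = (\<Sum>z\<in>?Z. ?g z * (if accepts A p (?\<sigma> z) then - 1 else 1))"
        by (intro sum.cong refl) auto
      also have "\<dots> \<le> 4 ^ (2 * p * s) * (2 * sqrt 12 ^ card ?I)"
        by (rule algorithm_correlation_le[OF length_parts _ _ p])
          (use parts_nonempty bits A gap_rectangle[of ?I] in auto)
      finally show ?thesis .
    qed
  qed auto
  with sum_abs_gap_ge[of ?I] show ?thesis
    by simp
qed

lemma power_inequality_bound:
  assumes "4 ^ m \<le> 6 * 4 ^ (2 * e) * sqrt 12 ^ m"
  shows "m < 20 * e + 13"
proof (rule ccontr)
  assume "\<not> m < 20 * e + 13"
  then have le: "20 * e + 13 \<le> m" by simp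
  have "(4 ^ m)\<^sup>2 \<le> (6 * 4 ^ (2 * e) * sqrt 12 ^ m)\<^sup>2"
    using assms by (intro power_mono) auto
  also have "\<dots> = 36 * 256 ^ e * 12 ^ m"
  proof -
    have "(sqrt 12 ^ m)\<^sup>2 = (12::real) ^ m"
      by (simp add: power_mult[symmetric] mult.commute[of m]) (simp add: power_mult)
    moreover have "((4::real) ^ (2 * e))\<^sup>2 = 256 ^ e"
      by (simp add: power_mult[symmetric] mult.commute[of "2 * e"]) (simp add: power_mult)
    ultimately show ?thesis
      by (simp add: power_mult_distrib)
  qed
  finally have "(16::real) ^ m \<le> 36 * 256 ^ e * 12 ^ m"
    by (simp add: power_mult[symmetric] mult.commute[of m]) (simp add: power_mult)
  moreover have "(16::real) ^ m = (4 / 3) ^ m * 12 ^ m"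
    by (simp add: power_mult_distrib[symmetric])
  ultimately have "(4 / 3 :: real) ^ m \<le> 36 * 256 ^ e"
    by simp
  moreover have "36 * 256 ^ e < (4 / 3 :: real) ^ m"
  proof -
    \<comment> \<open>The constants 20 and 13 come from (4 / 3) ^ 20 > 256 and (4 / 3) ^ 13 >
      36.\<close>
    have "(256::real) ^ e \<le> ((4 / 3) ^ 20) ^ e"
      by (intro power_mono) (simp_all add: power_divide)
    then have "36 * (256::real) ^ e < (4 / 3) ^ 13 * ((4 / 3) ^ 20) ^ e"
      by (intro mult_less_le_imp_less) (simp_all add: power_divide)
    also have "\<dots> = (4 / 3) ^ (20 * e + 13)"
      by (simp add: power_add power_mult)
    also have "\<dots> \<le> (4 / 3) ^ m"
      using le by (intro power_increasing) auto
    finally show ?thesis .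
  qed
  ultimately show False by linarith
qed

theorem theorem36:
  shows "\<exists>c :: real. c > 0 \<and> (\<exists>N :: nat.
    \<forall>(F :: nat pair_pre_digraph set) (D :: al_algorithm pmf) (n :: nat) (p :: nat).
      (\<forall>m G. n_vertex_graph m G \<and> max_degree G = 2 \<longrightarrow> G \<in> F) \<longrightarrow>
      n \<ge> N \<longrightarrow> p \<ge> 1 \<longrightarrow> solves_connectivity F n p D \<longrightarrow>
      (\<exists>G \<in> F. n_vertex_graph n G \<and>
        (\<exists>\<sigma>. al_stream G \<sigma> \<and>
          (\<exists>A \<in> set_pmf D. real (bits_used A p \<sigma>) \<ge> c * (real n / real p)))))"
\<comment> \<open>Since 480 = 20 * 24, the term 20 * p * s stays below n / 24, half of the roughly n
  / 12 blocks; from 1000 vertices on, the other half outweighs the additive constants.\<close>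
proof (intro exI[of _ "1 / 480"] conjI exI[of _ 1000] allI impI)
  fix F :: "nat pair_pre_digraph set" and D :: "al_algorithm pmf" and n p :: nat
  assume F: "\<forall>m G. n_vertex_graph m G \<and> max_degree G = 2 \<longrightarrow> G \<in> F"
    and "n \<ge> 1000" and p: "p \<ge> 1" and solves: "solves_connectivity F n p D"
  \<comment> \<open>The largest \<open>m\<close> for which the columns fit into \<open>n\<close>
    vertices.\<close>
  define m where "m = n div 12 - 1"
  have "n div 12 \<ge> 83" "12 * (n div 12) \<le> n"
    using div_le_mono[OF \<open>n \<ge> 1000\<close>, of 12] by simp_all
  then interpret strands m n
    by unfold_locales (simp_all add: m_def)
  have in_F: "functional_graph n (nxt X Y) \<in> F" if "X \<in> inputs" "Y \<in> inputs" for X Y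
    using F graph_of_inputs[OF that] by blast
  show "\<exists>G \<in> F. n_vertex_graph n G \<and> (\<exists>\<sigma>. al_stream G \<sigma> \<and>
      (\<exists>A \<in> set_pmf D. real (bits_used A p \<sigma>) \<ge> 1 / 480 * (real n / real p)))"
  proof (rule ccontr)
    assume contra: "\<not> ?thesis"
    \<comment> \<open>\<open>s = 0\<close> for many passes; this is harmless, since there are at most \<open>4 ^ s\<close> memory states even then.\<close>
    define s where "s = n div (480 * p)"
    have "4 ^ m \<le> 6 * 4 ^ (2 * p * s) * sqrt 12 ^ m"
    proof (rule memory_lower_bound[OF p])
      fix X Y assume XY: "X \<in> inputs" "Y \<in> inputs"
      show "measure_pmf.prob D {A. accepts A p (alice_part X @ bob_part Y)
          \<longleftrightarrow> Digraph_Component.connected (functional_graph n (nxt X Y))} \<ge> 2 / 3"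
        using solves in_F[OF XY] graph_of_inputs(1)[OF XY] al_stream_parts[OF XY]
        unfolding solves_connectivity_def by blast
      fix A assume "A \<in> set_pmf D"
      then have "real (bits_used A p (alice_part X @ bob_part Y)) < 1 / 480 * (real n / real p)"
        using contra in_F[OF XY] graph_of_inputs(1)[OF XY] al_stream_parts[OF XY] by force
      then have "real (bits_used A p (alice_part X @ bob_part Y) * (480 * p)) < real n"
        using p by (simp add: field_simps)
      then have "bits_used A p (alice_part X @ bob_part Y) * (480 * p) < n"
        by (simp only: of_nat_less_iff)
      then show "bits_used A p (alice_part X @ bob_part Y) \<le> s"
        using p unfolding s_def by (subst less_eq_div_iff_mult_less_eq) auto
    qed
    then have "m < 20 * (p * s) + 13"
      by (intro power_inequality_bound) (simp add: mult.assoc)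
    moreover have "480 * (p * s) \<le> n"
      using div_times_less_eq_dividend[of n "480 * p"] by (simp add: s_def mult_ac)
    ultimately show False
      using \<open>n \<ge> 1000\<close> unfolding m_def by linarith
  qed
qed simp

end
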